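(* Let $H$ be a finite additive group of odd order, and let $B\subset H$ be a Sidon set, that is to say a set $B=\{b_1,\dots,b_m\}$ (with $b_1,\dots,b_m$ distinct) whose sums $b_i+b_j$, $1\le i<j\le m$, are all distinct. Then $\phi(H\setminus B)<4$.
   Context: An additive group is an abelian group written with operation $+$. For subsets $A,B$ of an additive group $G$, $B$ is sum-avoiding in $A$ if there do not exist distinct $b_1,b_2\in B$ with $b_1+b_2\in A$. Define $\phi(A):=\sup\{|B| : B\subseteq A,\ B \text{ finite and sum-avoiding in } A\}$. *)

theory Defs
  imports "HOL-Library.Extended_Nat"
begin

definition sum_avoiding_in :: "'a::ab_group_add set \<Rightarrow> 'a set \<Rightarrow> bool" where
  "sum_avoiding_in B A \<longleftrightarrow> \<not> (\<exists>b1\<in>B. \<exists>b2\<in>B. b1 \<noteq> b2 \<and> b1 + b2 \<in> A)"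

(* The supremum is taken in the extended naturals, as A may be infinite and the
   cardinalities unbounded. *)
definition phi :: "'a::ab_group_add set \<Rightarrow> enat" where
  "phi A = (SUP B \<in> {B. B \<subseteq> A \<and> finite B \<and> sum_avoiding_in B A}. enat (card B))"

(* Only sums of two distinct elements are compared: i < j, not i \<le> j. *)
definition sidon_set :: "'a::ab_group_add set \<Rightarrow> bool" where
  "sidon_set B \<longleftrightarrow>
    (\<exists>(m::nat) (b :: nat \<Rightarrow> 'a).
       B = b ` {1..m} \<and> inj_on b {1..m} \<and>
       inj_on (\<lambda>(i, j). b i + b j) {(i, j). 1 \<le> i \<and> i < j \<and> j \<le> m})"

end

theory Submission
  imports Defs
begin

text \<open>
  Four distinct elements \<open>w\<close>, \<open>x\<close>, \<open>y\<close>, \<open>z\<close> cannot have all six pairwise sums in a Sidon set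
  of a group of odd order. The six sums split into three complementary pairs,
  \<open>{w + x, y + z}\<close>, \<open>{w + y, x + z}\<close> and \<open>{w + z, x + y}\<close>, all with the same total
  \<open>w + x + y + z\<close>. A sum from one of these pairs never equals a sum from another, since the
  two share exactly one summand. The Sidon property therefore lets at most one of the
  three pairs consist of two distinct elements (\<open>sidon_crossing_sums\<close>). So two of them
  collapse, say \<open>w + x = y + z\<close> and \<open>w + y = x + z\<close>; subtracting gives \<open>2(x - y) = 0\<close>, and in
  odd order this forces \<open>x = y\<close> (\<open>odd_order_no_involution\<close>). A set that is sum-avoiding in the
  complement of the Sidon set has all its pairwise sums in the Sidon set, so it has at most
  three elements.
\<close>

lemma sum_involution_const:
  fixes x :: "'a::ab_group_add"
  assumes "x + x = 0" and "finite A"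
  shows "(\<Sum>_\<in>A. x) = (if even (card A) then 0 else x)"
  using assms(2) by (induction A rule: finite_induct) (auto simp: assms(1))

text \<open>
  Translation by \<open>x\<close> permutes the group, so it leaves the sum of all elements unchanged; but it
  also adds \<open>x\<close> once for every element, an odd number of times.
\<close>

lemma odd_order_no_involution:
  fixes x :: "'a::{ab_group_add, finite}"
  assumes "odd (card (UNIV :: 'a set))" and "x + x = 0"
  shows "x = 0"
proof -
  have "(\<Sum>y\<in>UNIV. y) = (\<Sum>y\<in>UNIV. y + x)"
    by (rule sum.reindex_bij_witness[of _ "\<lambda>y. y + x" "\<lambda>y. y - x"]) auto
  also have "\<dots> = (\<Sum>y\<in>UNIV. y) + x"
    using sum_involution_const[OF assms(2), of "UNIV :: 'a set"] assms(1)
    by (simp add: sum.distrib)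
  finally show ?thesis
    by simp
qed

text \<open>
  This restates the Sidon property without an enumeration: commutativity lets each two-element
  subset be listed with increasing indices, where the injectivity of the sums applies.
\<close>

lemma sidon_set_sum_unique:
  assumes "sidon_set B" and B: "p \<in> B" "q \<in> B" "r \<in> B" "s \<in> B"
    and ne: "p \<noteq> q" "r \<noteq> s" and eq: "p + q = r + s"
  shows "{p, q} = {r, s}"
proof -
  obtain m b where Bb: "B = b ` {1..m}"
    and inj: "inj_on (\<lambda>(i, j). b i + b j) {(i, j). 1 \<le> i \<and> i < j \<and> j \<le> (m::nat)}"
    using assms(1) unfolding sidon_set_def by blast
  have ordered: "\<exists>i j. 1 \<le> i \<and> i < j \<and> j \<le> m \<and> {u, v} = {b i, b j} \<and> u + v = b i + b j"
    if uv: "u \<in> B" "v \<in> B" "u \<noteq> v" for u v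
  proof -
    obtain i j where ij: "i \<in> {1..m}" "j \<in> {1..m}" "u = b i" "v = b j"
      using uv Bb by blast
    with uv(3) consider "i < j" | "j < i"
      by (metis linorder_neqE_nat)
    then show ?thesis
    proof cases
      case 1
      then show ?thesis using ij by (intro exI[of _ i] exI[of _ j]) auto
    next
      case 2
      then show ?thesis
        using ij by (intro exI[of _ j] exI[of _ i]) (auto simp: add.commute)
    qed
  qed
  obtain i j where ij: "1 \<le> i" "i < j" "j \<le> m" "{p, q} = {b i, b j}" "p + q = b i + b j"
    using ordered[OF B(1,2) ne(1)] by blast
  obtain k l where kl: "1 \<le> k" "k < l" "l \<le> m" "{r, s} = {b k, b l}" "r + s = b k + b l"
    using ordered[OF B(3,4) ne(2)] by blast
  have "(i, j) = (k, l)"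
    by (rule inj_onD[OF inj]) (use ij kl eq in auto)
  then show ?thesis
    using ij(4) kl(4) by simp
qed

text \<open>
  Both pairs have the total \<open>w + x + y + z\<close>, so if neither collapsed they would be the same pair;
  but \<open>w + x\<close> shares one summand with each of \<open>w + y\<close> and \<open>x + z\<close> and so equals neither.
\<close>

lemma sidon_crossing_sums:
  assumes "sidon_set B"
    and "w + x \<in> B" "y + z \<in> B" "w + y \<in> B" "x + z \<in> B"
    and "x \<noteq> y" "w \<noteq> z"
  shows "w + x = y + z \<or> w + y = x + z"
proof (rule ccontr)
  assume "\<not> ?thesis"
  moreover have "(w + x) + (y + z) = (w + y) + (x + z)"
    by (simp add: ac_simps)
  ultimately have "{w + x, y + z} = {w + y, x + z}"
    using sidon_set_sum_unique[OF assms(1-5)] by blast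
  then have "w + x = w + y \<or> x + w = x + z"
    by (auto simp only: doubleton_eq_iff add.commute[of w x])
  then show False
    using assms(6,7) by simp
qed

lemma odd_order_crossing_sums_imp_eq:
  fixes w x y z :: "'a::{ab_group_add, finite}"
  assumes "odd (card (UNIV :: 'a set))" and "w + x = y + z" and "w + y = x + z"
  shows "x = y"
proof -
  have "(x - y) + (x - y) = (w + x - (y + z)) - (w + y - (x + z))"
    by (simp add: algebra_simps)
  also have "\<dots> = 0"
    using assms(2,3) by simp
  finally have "x - y = 0"
    by (rule odd_order_no_involution[OF assms(1)])
  then show ?thesis
    by simp
qed

lemma sidon_no_four_with_pairwise_sums:
  fixes B :: "'a::{ab_group_add, finite} set"
  assumes odd: "odd (card (UNIV :: 'a set))" and sidon: "sidon_set B"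
    and dist: "distinct [w, x, y, z]"
    and sums: "\<And>u v. u \<in> {w, x, y, z} \<Longrightarrow> v \<in> {w, x, y, z} \<Longrightarrow> u \<noteq> v \<Longrightarrow> u + v \<in> B"
  shows False
proof -
  note comm = add.commute[of z y] add.commute[of z x] add.commute[of y x]
  have "w + x = y + z \<or> w + y = x + z"
    by (rule sidon_crossing_sums[OF sidon]) (use dist in \<open>auto intro!: sums\<close>)
  moreover have "w + x = z + y \<or> w + z = x + y"
    by (rule sidon_crossing_sums[OF sidon]) (use dist in \<open>auto intro!: sums\<close>)
  moreover have "w + y = z + x \<or> w + z = y + x"
    by (rule sidon_crossing_sums[OF sidon]) (use dist in \<open>auto intro!: sums\<close>)
  \<comment> \<open>Of the three balanced equations at least two hold, but any two make two elements equal.\<close>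
  moreover have "\<not> (w + x = y + z \<and> w + y = x + z)"
    using odd_order_crossing_sums_imp_eq[OF odd, of w x y z] dist by auto
  moreover have "\<not> (w + x = z + y \<and> w + z = x + y)"
    using odd_order_crossing_sums_imp_eq[OF odd, of w x z y] dist by auto
  moreover have "\<not> (w + y = z + x \<and> w + z = y + x)"
    using odd_order_crossing_sums_imp_eq[OF odd, of w y z x] dist by auto
  ultimately show False
    unfolding comm by blast
qed

theorem proposition1p6:
  fixes B :: "'h::{ab_group_add, finite} set"
  assumes "odd (card (UNIV :: 'h set))"
    and "sidon_set B"
  shows "phi (UNIV - B) < 4"
proof -
  have "card S \<le> 3" if S: "sum_avoiding_in S (UNIV - B)" for S :: "'h set"
  proof (rule ccontr)
    assume "\<not> card S \<le> 3"
    then obtain T where T: "T \<subseteq> S" "card T = 4"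
      using obtain_subset_with_card_n[of 4 S] by force
    obtain xs where xs: "set xs = T" "distinct xs"
      using finite_distinct_list[OF finite[of T]] by blast
    have "length xs = Suc (Suc (Suc (Suc 0)))"
      using distinct_card[OF xs(2)] xs(1) T(2) by simp
    then obtain w x y z where "xs = [w, x, y, z]"
      unfolding length_Suc_conv length_0_conv by blast
    with xs have wxyz: "T = {w, x, y, z}" "distinct [w, x, y, z]"
      by auto
    show False
      by (rule sidon_no_four_with_pairwise_sums[OF assms wxyz(2)])
        (use S T(1) wxyz(1) in \<open>auto simp: sum_avoiding_in_def\<close>)
  qed
  then have "phi (UNIV - B) \<le> enat 3"
    unfolding phi_def by (intro SUP_least) auto
  also have "enat 3 < 4"
    by (simp add: numeral_eq_enat)
  finally show ?thesis .
qed

end
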